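(* Let $A\in\mathbb{M}_d$ and let $\mathcal{S}$ be a hyperplane of $\mathbb{C}^d$ orthogonal to the unit vector $h$. Set $$\beta=\min\{\|Ah\|^2,\|A^*h\|^2\}-|\langle h,Ah\rangle|^2.$$ Then, for all $j=1,\ldots,d-1$, $$\mu_j^2(A)\ \ge\ \mu_j^2(A_{\mathcal{S}})\ \ge\ \mu_{j+1}^2(A)-\beta.$$
   Context: $\mathbb{M}_d$ is the space of complex $d\times d$ matrices, acting on $\mathbb{C}^d$ with inner product $\langle h,x\rangle=h^*x$ and Euclidean norm. A hyperplane is a vector subspace of dimension $d-1$; here $\mathcal{S}=h^\perp$. The compression $A_{\mathcal{S}}$ is the operator on $\mathcal{S}$ defined as the restriction to $\mathcal{S}$ of $EA$, where $E$ is the orthogonal projection of $\mathbb{C}^d$ onto $\mathcal{S}$. $\mu_1\ge\mu_2\ge\cdots$ denote singular values in nonincreasing order (with multiplicity). *)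

theory Defs
  imports "HOL-Analysis.Analysis" "HOL-Library.Multiset"
begin

text \<open>
  The space \<open>\<complex>\<^sup>d\<close> is \<open>complex ^ 'n\<close> with \<open>d = CARD('n)\<close>, and its complex-linear structure is
  the one of the interpretation \<open>vec\<close>: \<open>vec.subspace\<close> and \<open>vec.dim\<close> are taken over the
  complex field. The inner product of the type class \<open>real_inner\<close> is only the real part of the
  complex one, which is therefore introduced separately; the library norm is its Euclidean norm.
\<close>

definition cinner :: "complex ^ 'n \<Rightarrow> complex ^ 'n \<Rightarrow> complex" where
  "cinner x y = (\<Sum>i\<in>UNIV. cnj (x $ i) * y $ i)"

definition conj_transpose :: "complex ^ 'n ^ 'm \<Rightarrow> complex ^ 'm ^ 'n" where
  "conj_transpose A = (\<chi> i j. cnj (A $ j $ i))"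

definition hyperplane :: "(complex ^ 'n) set \<Rightarrow> bool" where
  "hyperplane S \<longleftrightarrow> vec.subspace S \<and> vec.dim S = CARD('n) - 1"

definition orth_proj :: "(complex ^ 'n) set \<Rightarrow> complex ^ 'n \<Rightarrow> complex ^ 'n" where
  "orth_proj S x = (THE y. y \<in> S \<and> (\<forall>s\<in>S. cinner s (x - y) = 0))"

text \<open>
  An operator on a subspace \<open>S\<close> is represented by a function on the whole space of which only the
  values on \<open>S\<close> matter. The notions below take \<open>S\<close> as an explicit argument and are meant for
  complex-linear maps from \<open>S\<close> to \<open>S\<close>; a square matrix \<open>A\<close> is the operator \<open>(*v) A\<close> on \<open>UNIV\<close>.
\<close>

definition compression :: "(complex ^ 'n) set \<Rightarrow> complex ^ 'n ^ 'n \<Rightarrow> complex ^ 'n \<Rightarrow> complex ^ 'n" where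
  "compression S A x = orth_proj S (A *v x)"

definition adjoint_on ::
    "(complex ^ 'n) set \<Rightarrow> (complex ^ 'n \<Rightarrow> complex ^ 'n) \<Rightarrow> complex ^ 'n \<Rightarrow> complex ^ 'n" where
  "adjoint_on S T y = (THE z. z \<in> S \<and> (\<forall>x\<in>S. cinner (T x) y = cinner x z))"

definition eigenspace_on ::
    "(complex ^ 'n) set \<Rightarrow> (complex ^ 'n \<Rightarrow> complex ^ 'n) \<Rightarrow> complex \<Rightarrow> (complex ^ 'n) set" where
  "eigenspace_on S T c = {x \<in> S. T x = c *s x}"

text \<open>
  The singular values of \<open>T\<close> on \<open>S\<close> are the nonnegative square roots of the eigenvalues of
  \<open>T\<^sup>*T\<close>, where \<open>T\<^sup>*\<close> is the adjoint on \<open>S\<close>. As \<open>T\<^sup>*T\<close> is self-adjoint, the multiplicity of an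
  eigenvalue is the dimension of its eigenspace.
\<close>

definition singular_values ::
    "(complex ^ 'n) set \<Rightarrow> (complex ^ 'n \<Rightarrow> complex ^ 'n) \<Rightarrow> real multiset" where
  "singular_values S T =
     (let V = (\<lambda>s. eigenspace_on S (adjoint_on S T \<circ> T) (complex_of_real (s\<^sup>2)))
      in \<Sum>s | 0 \<le> s \<and> V s \<noteq> {0}. replicate_mset (vec.dim (V s)) s)"

text \<open>The index \<open>j\<close> counts from 1, in nonincreasing order.\<close>

definition singular_value ::
    "(complex ^ 'n) set \<Rightarrow> (complex ^ 'n \<Rightarrow> complex ^ 'n) \<Rightarrow> nat \<Rightarrow> real" where
  "singular_value S T j = rev (sorted_list_of_multiset (singular_values S T)) ! (j - 1)"

end

theory Submission
  imports Defs
begin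

text \<open>
  Courant and Fischer characterise \<open>\<mu>\<^sub>j(T)\<close>, for an operator \<open>T\<close> on a space of dimension \<open>m\<close>, as the
  least \<open>c \<ge> 0\<close> for which \<open>\<parallel>Tx\<parallel> \<le> c \<parallel>x\<parallel>\<close> holds on some subspace of dimension \<open>m - j + 1\<close>. That
  such a subspace exists for \<open>c = \<mu>\<^sub>j(T)\<close> is \<open>singular_value_subspace\<close>; that any such subspace bounds
  \<open>\<mu>\<^sub>j(T)\<close> is \<open>singular_value_le\<close>. Every inequality below is a transfer of an optimal subspace from
  one operator to the other. Write \<open>T = A\<^sub>S\<close>, \<open>E\<close> for the projection onto \<open>S\<close>, and note that
  \<open>\<parallel>Tx\<parallel>\<^sup>2 = \<parallel>Ax\<parallel>\<^sup>2 - \<bar>\<langle>h, Ax\<rangle>\<bar>\<^sup>2\<close> for \<open>x \<in> S\<close>.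

  \<^item> Upper bound. Intersecting an optimal subspace for \<open>A\<close> with \<open>S\<close> loses at most one dimension,
    which is also the difference between the dimensions of the ambient spaces, and \<open>\<parallel>Tx\<parallel> \<le> \<parallel>Ax\<parallel>\<close>.

  \<^item> Lower bound with \<open>\<parallel>A\<^sup>*h\<parallel>\<close>. Keep the optimal subspace \<open>W \<subseteq> S\<close> of \<open>T\<close>: its dimension is the one
    required for \<open>\<mu>\<^sub>j\<^sub>+\<^sub>1(A)\<close>. For \<open>x \<in> W\<close> the defect is \<open>\<langle>h, Ax\<rangle> = \<langle>EA\<^sup>*h, x\<rangle>\<close>, and
    \<open>\<parallel>EA\<^sup>*h\<parallel>\<^sup>2 = \<parallel>A\<^sup>*h\<parallel>\<^sup>2 - \<bar>\<langle>h, Ah\<rangle>\<bar>\<^sup>2\<close>.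

  \<^item> Lower bound with \<open>\<parallel>Ah\<parallel>\<close>. Enlarge \<open>W\<close> by \<open>h\<close> and cut with \<open>{x. \<langle>h, Ax\<rangle> = 0}\<close>, so that the
    dimension does not drop below that of \<open>W\<close>. For \<open>x = w + ch\<close> in the result,
    \<open>Ax = EAx = Tw + c EAh\<close>, and the Cauchy-Schwarz inequality in the plane gives
    \<open>\<parallel>Ax\<parallel>\<^sup>2 \<le> (\<mu>\<^sub>j(T)\<^sup>2 + \<parallel>EAh\<parallel>\<^sup>2) \<parallel>x\<parallel>\<^sup>2\<close>, where \<open>\<parallel>EAh\<parallel>\<^sup>2 = \<parallel>Ah\<parallel>\<^sup>2 - \<bar>\<langle>h, Ah\<rangle>\<bar>\<^sup>2\<close>. This direct argument
    avoids comparing the singular values of an operator with those of its adjoint.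

  The min-max principle rests on an orthonormal eigenbasis of \<open>T\<^sup>*T\<close> inside a subspace, which comes
  from the spectral theorem \<open>spectral_theorem_subspace\<close>.
\<close>

section \<open>The complex inner product\<close>

lemma cinner_add_left: "cinner (x + y) z = cinner x z + cinner y z"
  and cinner_add_right: "cinner z (x + y) = cinner z x + cinner z y"
  and cinner_diff_left: "cinner (x - y) z = cinner x z - cinner y z"
  and cinner_diff_right: "cinner z (x - y) = cinner z x - cinner z y"
  and cinner_scale_left: "cinner (c *s x) z = cnj c * cinner x z"
  and cinner_scale_right: "cinner z (c *s x) = c * cinner z x"
  by (simp_all add: cinner_def algebra_simps sum.distrib sum_subtractf sum_distrib_left)

lemma cinner_zero [simp]: "cinner 0 x = 0" "cinner x 0 = 0"
  by (simp_all add: cinner_def)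

lemmas cinner_simps = cinner_add_left cinner_add_right cinner_diff_left cinner_diff_right
  cinner_scale_left cinner_scale_right

lemma cinner_sum_left: "cinner (\<Sum>i\<in>I. f i) z = (\<Sum>i\<in>I. cinner (f i) z)"
  by (induction I rule: infinite_finite_induct) (simp_all add: cinner_add_left)

lemma cinner_sum_right: "cinner z (\<Sum>i\<in>I. f i) = (\<Sum>i\<in>I. cinner z (f i))"
  by (induction I rule: infinite_finite_induct) (simp_all add: cinner_add_right)

lemma cnj_cinner: "cnj (cinner x y) = cinner y x"
  by (simp add: cinner_def mult.commute)

lemma cinner_commute_zero: "cinner x y = 0 \<longleftrightarrow> cinner y x = 0"
  by (metis cnj_cinner complex_cnj_zero)

lemma inner_eq_Re_cinner: "x \<bullet> y = Re (cinner x y)"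
  by (simp add: inner_vec_def cinner_def inner_complex_def)

lemma cinner_self: "cinner x x = of_real ((norm x)\<^sup>2)"
proof (rule complex_eqI)
  show "Re (cinner x x) = Re (of_real ((norm x)\<^sup>2))"
    by (simp add: inner_eq_Re_cinner [symmetric] power2_norm_eq_inner)
  have "Im (cinner x x) = - Im (cinner x x)"
    using arg_cong [OF cnj_cinner [of x x], of Im] by simp
  then show "Im (cinner x x) = Im (of_real ((norm x)\<^sup>2))" by simp
qed

lemma norm_scale: "norm (c *s x) = cmod c * norm (x :: complex ^ 'n)"
proof -
  have "complex_of_real ((norm (c *s x))\<^sup>2) = cnj c * (c * of_real ((norm x)\<^sup>2))"
    by (simp only: cinner_self [symmetric] cinner_scale_left cinner_scale_right mult_ac)
  also have "\<dots> = of_real ((cmod c * norm x)\<^sup>2)"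
    by (simp only: power_mult_distrib of_real_mult complex_norm_square mult_ac)
  finally have "(norm (c *s x))\<^sup>2 = (cmod c * norm x)\<^sup>2" by (simp only: of_real_eq_iff)
  then show ?thesis by simp
qed

lemma norm_add_orthogonal:
  assumes "cinner x y = 0"
  shows "(norm (x + y))\<^sup>2 = (norm x)\<^sup>2 + (norm y)\<^sup>2"
proof -
  have "of_real ((norm (x + y))\<^sup>2) = (of_real ((norm x)\<^sup>2 + (norm y)\<^sup>2) :: complex)"
    using assms cinner_commute_zero [of x y]
    by (simp only: cinner_self [symmetric] cinner_simps of_real_add) simp
  then show ?thesis by (simp only: of_real_eq_iff)
qed

lemma norm_sum_orthogonal:
  assumes "finite C" and "\<And>v w. v \<in> C \<Longrightarrow> w \<in> C \<Longrightarrow> v \<noteq> w \<Longrightarrow> cinner (f v) (f w) = 0"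
  shows "(norm (\<Sum>v\<in>C. c v *s f v))\<^sup>2 = (\<Sum>v\<in>C. (cmod (c v))\<^sup>2 * (norm (f v))\<^sup>2)"
  using assms
proof (induction C rule: finite_induct)
  case (insert a C)
  have "cinner (c a *s f a) (\<Sum>v\<in>C. c v *s f v) = 0"
  proof -
    have "cinner (f a) (f v) = 0" if "v \<in> C" for v
      using that insert.hyps insert.prems by blast
    then show ?thesis by (simp add: cinner_sum_right cinner_simps)
  qed
  from norm_add_orthogonal [OF this] insert show ?case
    by (simp add: norm_scale power_mult_distrib)
qed simp

lemma cinner_adjoint_matrix: "cinner h (A *v x) = cinner (conj_transpose A *v h) x"
proof -
  have "cinner h (A *v x) = (\<Sum>i\<in>UNIV. \<Sum>j\<in>UNIV. cnj (h $ i) * A $ i $ j * x $ j)"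
    by (simp add: cinner_def matrix_vector_mult_def sum_distrib_left mult.assoc)
  also have "\<dots> = (\<Sum>j\<in>UNIV. \<Sum>i\<in>UNIV. cnj (h $ i) * A $ i $ j * x $ j)"
    by (rule sum.swap)
  also have "\<dots> = cinner (conj_transpose A *v h) x"
    by (simp add: cinner_def matrix_vector_mult_def conj_transpose_def sum_distrib_right sum_distrib_left mult_ac)
  finally show ?thesis .
qed

lemma cinner_eqI:
  assumes "vec.subspace S" "x \<in> S" "y \<in> S" "\<And>s. s \<in> S \<Longrightarrow> cinner s x = cinner s y"
  shows "x = y"
proof -
  have "cinner (x - y) (x - y) = 0"
    using assms vec.subspace_diff [OF assms(1-3)] by (simp add: cinner_diff_right)
  then show ?thesis by (simp add: cinner_self)
qed

text \<open>Projecting \<open>y\<close> onto the line of \<open>x\<close> shortens it.\<close>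

lemma cauchy_schwarz_cinner: "cmod (cinner x y) \<le> norm x * norm y"
proof (cases "norm x = 0")
  case False
  define c where "c = cinner x y / of_real ((norm x)\<^sup>2)"
  have "cinner (c *s x) (y - c *s x) = 0"
  proof -
    have "c * of_real ((norm x)\<^sup>2) = cinner x y" using False by (simp add: c_def)
    then show ?thesis by (simp only: cinner_simps) (simp add: cinner_self)
  qed
  from norm_add_orthogonal [OF this] have "(norm (c *s x))\<^sup>2 \<le> (norm y)\<^sup>2" by simp
  then have "norm (c *s x) \<le> norm y" by (simp add: power2_le_iff_abs_le)
  then show ?thesis using False
    by (simp add: norm_scale c_def norm_divide norm_mult power2_eq_square field_simps)
qed simp

section \<open>Orthonormal systems and the spectral theorem\<close>

definition orthonormal :: "(complex ^ 'n) set \<Rightarrow> bool" where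
  "orthonormal B \<longleftrightarrow> finite B \<and> (\<forall>v\<in>B. \<forall>w\<in>B. cinner v w = (if v = w then 1 else 0))"

lemma orthonormal_subset: "orthonormal B \<Longrightarrow> C \<subseteq> B \<Longrightarrow> orthonormal C"
  by (simp add: orthonormal_def finite_subset subset_iff)

lemma orthonormal_cinner_sum:
  assumes "orthonormal B" "v \<in> B"
  shows "cinner v (\<Sum>w\<in>B. c w *s w) = c v"
proof -
  have "cinner v (\<Sum>w\<in>B. c w *s w) = (\<Sum>w\<in>B. if w = v then c w else 0)"
    unfolding cinner_sum_right
    using assms by (intro sum.cong) (auto simp: cinner_simps orthonormal_def)
  then show ?thesis using assms by (simp add: orthonormal_def)
qed

lemma orthonormal_expansion:
  assumes "orthonormal B" "x \<in> vec.span B"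
  shows "(\<Sum>v\<in>B. cinner v x *s v) = x"
proof -
  obtain c where c: "x = (\<Sum>v\<in>B. c v *s v)"
    using assms vec.span_finite [of B] by (auto simp: orthonormal_def)
  show ?thesis unfolding c
    by (intro sum.cong) (simp_all only: orthonormal_cinner_sum [OF assms(1)])
qed

lemma dim_span_orthonormal:
  assumes "orthonormal B"
  shows "vec.dim (vec.span B) = card B"
proof -
  have "vec.independent B"
    unfolding vec.independent_explicit
    using assms orthonormal_cinner_sum [OF assms] by (metis cinner_zero(2) orthonormal_def)
  then show ?thesis by (rule vec.dim_span_eq_card_independent)
qed

text \<open>Near \<open>0\<close> the linear term dominates, so it would make the quadratic change sign.\<close>

lemma nonneg_quadratic_imp_linear_coeff_zero:
  fixes a b :: real
  assumes "\<And>t. 0 \<le> a * t + b * t\<^sup>2" and "0 \<le> b"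
  shows "a = 0"
proof (rule ccontr)
  assume "a \<noteq> 0"
  define t where "t = - a / (b + 1)"
  have "a = - (b + 1) * t" using assms(2) by (simp add: t_def field_simps)
  then have "a * t + b * t\<^sup>2 = - (b + 1) * t * t + b * t\<^sup>2" by (rule arg_cong)
  also have "\<dots> = - t\<^sup>2" by (simp add: power2_eq_square algebra_simps)
  finally have "a * t + b * t\<^sup>2 = - t\<^sup>2" .
  moreover have "t \<noteq> 0" using \<open>a \<noteq> 0\<close> assms(2) by (simp add: t_def)
  ultimately show False using assms(1) [of t] by simp
qed

lemma scaleR_eq_scale: "r *\<^sub>R (x :: complex ^ 'n) = of_real r *s x"
  by (simp add: vec_eq_iff scaleR_conv_of_real [where 'a = complex])

lemma linear_vec_linear:
  assumes "Vector_Spaces.linear (*s) (*s) (P :: complex ^ 'n \<Rightarrow> complex ^ 'm)"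
  shows "linear P"
  by (rule linearI) (simp_all add: scaleR_eq_scale vec.linear_add [OF assms] vec.linear_scale [OF assms])

lemma subspace_vec_subspace: "vec.subspace (S :: (complex ^ 'n) set) \<Longrightarrow> subspace S"
  by (simp add: subspace_def vec.subspace_def scaleR_eq_scale)

text \<open>
  A unit vector that maximises the Rayleigh quotient is an eigenvector: with \<open>l\<close> the maximum, the form
  \<open>l \<parallel>x\<parallel>\<^sup>2 - \<langle>x, Px\<rangle>\<close> is nonnegative on \<open>S\<close> and vanishes at \<open>v\<close>, so its derivative at \<open>v\<close> in the
  direction \<open>w = l v - Pv\<close>, which is \<open>2 \<parallel>w\<parallel>\<^sup>2\<close>, must be zero. The argument needs only real parts and
  therefore uses the real inner product.
\<close>

lemma selfadjoint_eigenvector: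
  fixes P :: "complex ^ 'n \<Rightarrow> complex ^ 'n"
  assumes lin: "Vector_Spaces.linear (*s) (*s) P"
    and S: "vec.subspace S" "\<not> S \<subseteq> {0}"
    and inv: "\<And>x. x \<in> S \<Longrightarrow> P x \<in> S"
    and adj: "\<And>x y. x \<in> S \<Longrightarrow> y \<in> S \<Longrightarrow> cinner (P x) y = cinner x (P y)"
  obtains v l where "v \<in> S" "norm v = 1" "P v = of_real l *s v"
proof -
  note lin' = linear_vec_linear [OF lin] and S' = subspace_vec_subspace [OF S(1)]
  let ?K = "S \<inter> sphere 0 1"
  obtain x0 where "x0 \<in> S" "x0 \<noteq> 0" using S(2) by auto
  then have "(1 / norm x0) *\<^sub>R x0 \<in> ?K" using S' by (simp add: subspace_scale)
  then have "?K \<noteq> {}" by blast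
  moreover have "compact ?K"
    by (intro closed_Int_compact closed_subspace S' compact_sphere)
  moreover have "continuous_on ?K (\<lambda>x. x \<bullet> P x)"
    by (intro continuous_intros linear_continuous_on lin'[unfolded linear_conv_bounded_linear])
  ultimately obtain v where v: "v \<in> ?K" and max: "\<And>y. y \<in> ?K \<Longrightarrow> y \<bullet> P y \<le> v \<bullet> P v"
    using continuous_attains_sup [of ?K "\<lambda>x. x \<bullet> P x"] by blast
  define l where "l = v \<bullet> P v"
  have bound: "y \<bullet> P y \<le> l * (y \<bullet> y)" if "y \<in> S" for y
  proof (cases "y = 0")
    case False
    have "(1 / norm y) *\<^sub>R y \<in> ?K" using that False S' by (simp add: subspace_scale)
    from max [OF this] have "(y \<bullet> P y) / (norm y)\<^sup>2 \<le> l"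
      by (simp add: linear_cmul [OF lin'] l_def power2_eq_square)
    then show ?thesis using False by (simp add: field_simps power2_norm_eq_inner)
  qed (simp add: linear_0 [OF lin'])
  define w where "w = l *\<^sub>R v - P v"
  have vS: "v \<in> S" and vn: "v \<bullet> v = 1"
    using v by (simp_all add: norm_eq_1)
  have wS: "w \<in> S"
    unfolding w_def using vS inv S' by (simp add: subspace_diff subspace_scale)
  have sym: "w \<bullet> P v = v \<bullet> P w"
    using adj [OF vS wS] by (metis inner_commute inner_eq_Re_cinner)
  have "2 * (w \<bullet> w) = 0"
  proof (rule nonneg_quadratic_imp_linear_coeff_zero)
    show "0 \<le> l * (w \<bullet> w) - w \<bullet> P w" using bound [OF wS] by simp
    fix t :: real
    have ww: "w \<bullet> w = l * (v \<bullet> w) - v \<bullet> P w"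
    proof -
      have "w \<bullet> w = l * (w \<bullet> v) - w \<bullet> P v"
        by (subst (2) w_def) (simp add: inner_diff_right)
      then show ?thesis using sym by (simp add: inner_commute)
    qed
    have "v + t *\<^sub>R w \<in> S" using vS wS S' by (simp add: subspace_add subspace_scale)
    from bound [OF this]
    have "0 \<le> l * ((v + t *\<^sub>R w) \<bullet> (v + t *\<^sub>R w)) - (v + t *\<^sub>R w) \<bullet> P (v + t *\<^sub>R w)"
      by simp
    also have "\<dots> = 2 * (w \<bullet> w) * t + (l * (w \<bullet> w) - w \<bullet> P w) * t\<^sup>2"
    proof -
      have eqs: "v \<bullet> P w = l * (v \<bullet> w) - w \<bullet> w" "w \<bullet> P v = l * (v \<bullet> w) - w \<bullet> w"
        using ww sym by simp_all
      show ?thesis using vn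
        by (simp add: eqs linear_add [OF lin'] linear_cmul [OF lin'] inner_add_left inner_add_right
            inner_commute [of w v] l_def [symmetric] power2_eq_square algebra_simps)
    qed
    finally show "0 \<le> 2 * (w \<bullet> w) * t + (l * (w \<bullet> w) - w \<bullet> P w) * t\<^sup>2" .
  qed
  then have "P v = of_real l *s v" by (simp add: w_def scaleR_eq_scale)
  with vS v that show ?thesis by simp
qed

text \<open>
  Induction on the dimension: the orthogonal complement in \<open>S\<close> of an eigenvector is again invariant
  under \<open>P\<close>, because \<open>P\<close> is self-adjoint on \<open>S\<close>.
\<close>

theorem spectral_theorem_subspace:
  fixes P :: "complex ^ 'n \<Rightarrow> complex ^ 'n"
  assumes lin: "Vector_Spaces.linear (*s) (*s) P"
    and "vec.subspace S"
    and "\<And>x. x \<in> S \<Longrightarrow> P x \<in> S"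
    and "\<And>x y. x \<in> S \<Longrightarrow> y \<in> S \<Longrightarrow> cinner (P x) y = cinner x (P y)"
  shows "\<exists>B. orthonormal B \<and> vec.span B = S \<and> (\<forall>v\<in>B. \<exists>l::real. P v = of_real l *s v)"
  using assms(2-)
proof (induction "vec.dim S" arbitrary: S rule: less_induct)
  case less
  note S = less.prems(1)
  show ?case
  proof (cases "S \<subseteq> {0}")
    case True
    then have "vec.span {} = S" using vec.subspace_0 [OF S] by auto
    then show ?thesis by (intro exI [of _ "{}"]) (simp add: orthonormal_def)
  next
    case False
    obtain v l where v: "v \<in> S" "norm v = 1" and Pv: "P v = of_real l *s v"
      using selfadjoint_eigenvector [OF lin S False less.prems(2,3)] by metis
    have vv: "cinner v v = 1" using v by (simp add: cinner_self)
    define S' where "S' = {x \<in> S. cinner v x = 0}"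
    have S': "vec.subspace S'"
      using S by (simp add: S'_def vec.subspace_def cinner_simps)
    have "v \<notin> S'" using vv by (simp add: S'_def)
    then have "S' \<subset> S" using v by (auto simp: S'_def)
    then have "vec.dim S' < vec.dim S"
      using S S' by (metis vec.dim_psubset vec.span_eq_iff)
    moreover have "P x \<in> S'" if "x \<in> S'" for x
      using that less.prems(2) less.prems(3) [OF v(1), of x]
      by (simp add: S'_def Pv cinner_simps)
    moreover have "cinner (P x) y = cinner x (P y)" if "x \<in> S'" "y \<in> S'" for x y
      using that less.prems(3) by (simp add: S'_def)
    ultimately obtain B where B: "orthonormal B" "vec.span B = S'"
        "\<forall>v\<in>B. \<exists>l::real. P v = of_real l *s v"
      using less.hyps [of S'] S' by blast
    have BS': "B \<subseteq> S'" using B(2) vec.span_superset by blast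
    have "orthonormal (insert v B)"
      using B(1) BS' vv by (auto simp: orthonormal_def S'_def cinner_commute_zero [of _ v])
    moreover have "vec.span (insert v B) = S"
    proof
      show "vec.span (insert v B) \<subseteq> S"
        using S v BS' by (intro vec.span_minimal) (auto simp: S'_def)
      show "S \<subseteq> vec.span (insert v B)"
      proof
        fix x assume x: "x \<in> S"
        have "x - cinner v x *s v \<in> S'"
          using x v S vv by (simp add: S'_def cinner_simps vec.subspace_diff vec.subspace_scale)
        then show "x \<in> vec.span (insert v B)"
          using B(2) vec.span_insert [of v B] by blast
      qed
    qed
    moreover have "\<forall>w\<in>insert v B. \<exists>l::real. P w = of_real l *s w" using B(3) Pv by blast
    ultimately show ?thesis by blast
  qed
qed

text \<open>The identity is self-adjoint.\<close>

corollary subspace_orthonormal_basis: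
  assumes "vec.subspace S"
  obtains B where "orthonormal B" "vec.span B = S"
  using spectral_theorem_subspace [OF vec.linear_id assms] by (auto simp: id_def)

section \<open>Singular vectors and singular values\<close>

text \<open>
  In an orthonormal basis \<open>B\<close> of \<open>S\<close> the adjoint is given by the Riesz vector
  \<open>\<Sum>v\<in>B. \<langle>Tv, y\<rangle> v\<close>.
\<close>

lemma adjoint_on_in_subspace:
  assumes "vec.subspace S" "Vector_Spaces.linear (*s) (*s) T"
  shows "adjoint_on S T y \<in> S \<and> (\<forall>x\<in>S. cinner (T x) y = cinner x (adjoint_on S T y))"
  unfolding adjoint_on_def
proof (rule theI')
  obtain B where B: "orthonormal B" "vec.span B = S"
    using subspace_orthonormal_basis [OF assms(1)] .
  let ?z = "\<Sum>v\<in>B. cinner (T v) y *s v"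
  show "\<exists>!z. z \<in> S \<and> (\<forall>x\<in>S. cinner (T x) y = cinner x z)"
  proof (rule ex_ex1I)
    have "?z \<in> S" unfolding B(2) [symmetric]
      by (intro vec.span_sum vec.span_scale vec.span_base)
    moreover have "cinner (T x) y = cinner x ?z" if "x \<in> S" for x
    proof -
      have "T x = (\<Sum>v\<in>B. cinner v x *s T v)"
        using that B arg_cong [OF orthonormal_expansion [of B x], of T]
        by (simp add: vec.linear_sum [OF assms(2)] vec.linear_scale [OF assms(2)])
      then show ?thesis
        by (simp add: cinner_sum_left cinner_sum_right cinner_simps cnj_cinner mult.commute)
    qed
    ultimately show "\<exists>z. z \<in> S \<and> (\<forall>x\<in>S. cinner (T x) y = cinner x z)" by blast
  qed (metis assms(1) cinner_eqI)
qed

lemma adjoint_on_linear: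
  assumes "vec.subspace S" "Vector_Spaces.linear (*s) (*s) T"
  shows "Vector_Spaces.linear (*s) (*s) (adjoint_on S T)"
proof -
  note adj = adjoint_on_in_subspace [OF assms]
  have mem: "adjoint_on S T y \<in> S" for y using adj by blast
  have eq: "cinner x (adjoint_on S T y) = cinner (T x) y" if "x \<in> S" for x y
    using adj that by simp
  have "adjoint_on S T (x + y) = adjoint_on S T x + adjoint_on S T y" for x y
    by (rule cinner_eqI [OF assms(1)])
      (auto simp: mem eq cinner_simps vec.subspace_add [OF assms(1)])
  moreover have "adjoint_on S T (c *s x) = c *s adjoint_on S T x" for c x
    by (rule cinner_eqI [OF assms(1)])
      (auto simp: mem eq cinner_simps vec.subspace_scale [OF assms(1)])
  ultimately show ?thesis by (simp add: Vector_Spaces.linear_iff vec.vector_space_axioms)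
qed

text \<open>
  Right singular vectors. The eigenvalue of \<open>T\<^sup>*T\<close> at a unit eigenvector \<open>v\<close> is
  \<open>\<langle>v, T\<^sup>*Tv\<rangle> = \<parallel>Tv\<parallel>\<^sup>2\<close>, so the singular value that belongs to \<open>v\<close> is \<open>\<parallel>Tv\<parallel>\<close>.
\<close>

lemma singular_vectors:
  fixes T :: "complex ^ 'n \<Rightarrow> complex ^ 'n"
  assumes S: "vec.subspace S" and lin: "Vector_Spaces.linear (*s) (*s) T"
  obtains B where "orthonormal B" "vec.span B = S"
    "\<And>v. v \<in> B \<Longrightarrow> adjoint_on S T (T v) = of_real ((norm (T v))\<^sup>2) *s v"
    "\<And>v w. v \<in> B \<Longrightarrow> w \<in> B \<Longrightarrow> v \<noteq> w \<Longrightarrow> cinner (T v) (T w) = 0"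
proof -
  define P where "P = adjoint_on S T \<circ> T"
  have P: "P x \<in> S" "y \<in> S \<Longrightarrow> cinner y (P x) = cinner (T y) (T x)" for x y
    using adjoint_on_in_subspace [OF S lin] by (simp_all add: P_def)
  have "\<exists>B. orthonormal B \<and> vec.span B = S \<and> (\<forall>v\<in>B. \<exists>l::real. P v = of_real l *s v)"
  proof (rule spectral_theorem_subspace)
    show "Vector_Spaces.linear (*s) (*s) P"
      unfolding P_def using lin adjoint_on_linear [OF S lin] by (rule Vector_Spaces.linear_compose)
    show "cinner (P x) y = cinner x (P y)" if "x \<in> S" "y \<in> S" for x y
      using P(2) [OF that(1), of y] P(2) [OF that(2), of x] by (metis cnj_cinner)
  qed (use S P(1) in auto)
  then obtain B where B: "orthonormal B" "vec.span B = S" "\<forall>v\<in>B. \<exists>l::real. P v = of_real l *s v"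
    by blast
  have BS: "B \<subseteq> S" using B(2) vec.span_superset by blast
  have TT: "cinner (T v) (T w) = cinner v (P w)" if "v \<in> B" for v w
    using P(2) [of v w] BS that by auto
  have eig: "P v = of_real ((norm (T v))\<^sup>2) *s v" if v: "v \<in> B" for v
  proof -
    obtain l :: real where l: "P v = of_real l *s v" using B(3) v by blast
    then have "of_real ((norm (T v))\<^sup>2) = (of_real l :: complex)"
      using TT [OF v, of v] B(1) v by (simp only: cinner_self [symmetric])
        (simp add: cinner_simps orthonormal_def)
    then show ?thesis using l by simp
  qed
  show ?thesis
  proof (rule that [OF B(1,2)])
    show "adjoint_on S T (T v) = of_real ((norm (T v))\<^sup>2) *s v" if "v \<in> B" for v
      using eig [OF that] by (simp add: P_def)
    show "cinner (T v) (T w) = 0" if "v \<in> B" "w \<in> B" "v \<noteq> w" for v w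
      using TT [of v w] eig [of w] that B(1) by (simp add: cinner_simps orthonormal_def)
  qed
qed

text \<open>
  The eigenspace for \<open>s\<^sup>2\<close> is spanned by the basis vectors with \<open>\<parallel>Tv\<parallel> = s\<close>: comparing coefficients in
  \<open>T\<^sup>*Tx = s\<^sup>2 x\<close> kills all other coefficients of \<open>x\<close>. Its dimension is thus the number of times that
  \<open>s\<close> occurs among the norms \<open>\<parallel>Tv\<parallel>\<close>.
\<close>

lemma singular_values_eq_image:
  fixes T :: "complex ^ 'n \<Rightarrow> complex ^ 'n"
  assumes S: "vec.subspace S" and lin: "Vector_Spaces.linear (*s) (*s) T"
    and B: "orthonormal B" "vec.span B = S"
    and eig: "\<And>v. v \<in> B \<Longrightarrow> adjoint_on S T (T v) = of_real ((norm (T v))\<^sup>2) *s v"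
  shows "singular_values S T = image_mset (\<lambda>v. norm (T v)) (mset_set B)"
proof -
  define P where "P = adjoint_on S T \<circ> T"
  have linP: "Vector_Spaces.linear (*s) (*s) P"
    unfolding P_def using lin adjoint_on_linear [OF S lin] by (rule Vector_Spaces.linear_compose)
  have fin: "finite B" using B(1) by (simp add: orthonormal_def)
  have eigP: "P v = of_real ((norm (T v))\<^sup>2) *s v" if "v \<in> B" for v
    using eig [OF that] by (simp add: P_def)
  define V where "V s = eigenspace_on S P (complex_of_real (s\<^sup>2))" for s :: real
  define C where "C s = {v \<in> B. norm (T v) = s}" for s
  have V: "V s = vec.span (C s)" if s: "0 \<le> s" for s
  proof
    have "v \<in> V s" if "v \<in> C s" for v
      using that eigP [of v] vec.span_base [of v B] B(2) by (auto simp: V_def C_def eigenspace_on_def)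
    moreover have "vec.subspace (V s)"
      using S by (simp add: V_def eigenspace_on_def vec.subspace_def vec.linear_0 [OF linP]
          vec.linear_add [OF linP] vec.linear_scale [OF linP] vec.scale_right_distrib mult.commute)
    ultimately show "vec.span (C s) \<subseteq> V s" by (intro vec.span_minimal) auto
    show "V s \<subseteq> vec.span (C s)"
    proof
      fix x assume x: "x \<in> V s"
      then have xS: "x \<in> S" and Px: "P x = of_real (s\<^sup>2) *s x"
        by (auto simp: V_def eigenspace_on_def)
      have exp: "(\<Sum>v\<in>B. cinner v x *s v) = x"
        using orthonormal_expansion [OF B(1)] xS B(2) by blast
      have "P x = (\<Sum>v\<in>B. cinner v x *s P v)"
        using arg_cong [OF exp, of P]
        by (simp add: vec.linear_sum [OF linP] vec.linear_scale [OF linP])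
      also have "\<dots> = (\<Sum>v\<in>B. (cinner v x * of_real ((norm (T v))\<^sup>2)) *s v)"
        by (intro sum.cong) (auto simp: eigP)
      finally have Px': "P x = (\<Sum>v\<in>B. (cinner v x * of_real ((norm (T v))\<^sup>2)) *s v)" .
      have zero: "cinner v x = 0" if "v \<in> B" "norm (T v) \<noteq> s" for v
      proof -
        have "cinner v x * of_real ((norm (T v))\<^sup>2) = of_real (s\<^sup>2) * cinner v x"
          using orthonormal_cinner_sum
            [OF B(1) that(1), of "\<lambda>v. cinner v x * of_real ((norm (T v))\<^sup>2)"]
          by (simp only: Px' [symmetric]) (simp only: Px cinner_scale_right)
        then have "cinner v x = 0 \<or> (of_real ((norm (T v))\<^sup>2) :: complex) = of_real (s\<^sup>2)"
          by (simp only: mult.commute [of "cinner v x"] mult_cancel_right)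
        moreover have "(norm (T v))\<^sup>2 \<noteq> s\<^sup>2"
          using that s by simp
        ultimately show ?thesis by (simp only: of_real_eq_iff) blast
      qed
      have "(\<Sum>v\<in>B. cinner v x *s v) = (\<Sum>v\<in>C s. cinner v x *s v)"
        by (rule sum.mono_neutral_right) (auto simp: fin C_def zero)
      with exp have "x = (\<Sum>v\<in>C s. cinner v x *s v)" by (rule trans [OF sym])
      also have "\<dots> \<in> vec.span (C s)"
        by (intro vec.span_sum vec.span_scale vec.span_base)
      finally show "x \<in> vec.span (C s)" .
    qed
  qed
  have dimV: "vec.dim (V s) = card (C s)" if "0 \<le> s" for s
    unfolding V [OF that]
    by (intro dim_span_orthonormal orthonormal_subset [OF B(1)]) (auto simp: C_def)
  have nontrivial: "V s \<noteq> {0} \<longleftrightarrow> C s \<noteq> {}" if "0 \<le> s" for s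
  proof -
    have "card (C s) = 0 \<longleftrightarrow> V s \<subseteq> {0}" 
      using dimV [OF that] vec.dim_eq_0 [of "V s"] by simp
    moreover have "0 \<in> V s" unfolding V [OF that] by (rule vec.span_zero)
    moreover have "finite (C s)" using fin by (simp add: C_def)
    ultimately show ?thesis by auto
  qed
  have "{s. 0 \<le> s \<and> V s \<noteq> {0}} = {s. 0 \<le> s \<and> C s \<noteq> {}}"
    using nontrivial by (intro Collect_cong conj_cong refl)
  also have "\<dots> = (\<lambda>v. norm (T v)) ` B" by (force simp: C_def)
  finally have idx: "{s. 0 \<le> s \<and> V s \<noteq> {0}} = (\<lambda>v. norm (T v)) ` B" .
  have "singular_values S T = (\<Sum>s | 0 \<le> s \<and> V s \<noteq> {0}. replicate_mset (vec.dim (V s)) s)"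
    by (simp add: singular_values_def V_def P_def Let_def)
  also have "\<dots> = (\<Sum>s\<in>(\<lambda>v. norm (T v)) ` B. replicate_mset (card (C s)) s)"
    unfolding idx by (intro sum.cong) (auto simp: dimV)
  also have "\<dots> = image_mset (\<lambda>v. norm (T v)) (mset_set B)"
  proof (rule multiset_eqI)
    fix s
    have "count (\<Sum>s\<in>(\<lambda>v. norm (T v)) ` B. replicate_mset (card (C s)) s) s
        = (\<Sum>r\<in>(\<lambda>v. norm (T v)) ` B. if r = s then card (C s) else 0)"
      by (auto simp: count_sum intro!: sum.cong)
    also have "\<dots> = card (C s)"
      using fin by (auto simp: C_def card_eq_0_iff)
    also have "\<dots> = count (image_mset (\<lambda>v. norm (T v)) (mset_set B)) s"
      using fin by (simp add: count_image_mset C_def vimage_def Int_def conj_commute)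
    finally show "count (\<Sum>s\<in>(\<lambda>v. norm (T v)) ` B. replicate_mset (card (C s)) s) s
        = count (image_mset (\<lambda>v. norm (T v)) (mset_set B)) s" .
  qed
  finally show ?thesis .
qed

text \<open>
  Both bounds count elements on one side of \<open>t\<close>, and such counts translate directly into dimensions
  of spans of singular vectors.
\<close>

lemma jth_largest:
  fixes M :: "'a::linorder multiset"
  assumes "1 \<le> j" "j \<le> size M"
  defines "t \<equiv> rev (sorted_list_of_multiset M) ! (j - 1)"
  shows "size (filter_mset (\<lambda>x. t < x) M) < j" and "t \<in># M" and "j \<le> size (filter_mset (\<lambda>x. t \<le> x) M)"
proof -
  define xs where "xs = rev (sorted_list_of_multiset M)"
  have M: "M = mset xs" by (simp add: xs_def)
  have len: "length xs = size M" by (simp add: M)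
  have dec: "xs ! k \<le> xs ! i" if "i \<le> k" "k < length xs" for i k
    using that sorted_rev_nth_mono [of xs i k] by (simp add: xs_def sorted_sorted_list_of_multiset)
  have size: "size (filter_mset Q M) = card {i. i < length xs \<and> Q (xs ! i)}" for Q
    by (simp add: M length_filter_conv_card flip: mset_filter)
  have "{i. i < length xs \<and> t < xs ! i} \<subseteq> {..<j - 1}"
    using dec [of "j - 1"] by (auto simp: t_def xs_def [symmetric] not_le [symmetric] simp del: not_le)
  from card_mono [OF _ this] show "size (filter_mset (\<lambda>x. t < x) M) < j"
    using assms(1) by (simp add: size)
  have "t \<in> set xs" using assms(1,2) len by (simp add: t_def xs_def [symmetric])
  then show "t \<in># M" by (simp add: M)
  have "{..<j} \<subseteq> {i. i < length xs \<and> t \<le> xs ! i}"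
    using assms(1,2) len dec [of _ "j - 1"] by (auto simp: t_def xs_def [symmetric])
  from card_mono [OF _ this] show "j \<le> size (filter_mset (\<lambda>x. t \<le> x) M)"
    by (simp add: size)
qed

section \<open>The min-max principle\<close>

lemma dim_Int_ge:
  assumes "vec.subspace U" "vec.subspace W" "vec.subspace S" "U \<subseteq> S" "W \<subseteq> S"
  shows "vec.dim U + vec.dim W \<le> vec.dim S + vec.dim (U \<inter> W)"
proof -
  have "{x + y |x y. x \<in> U \<and> y \<in> W} \<subseteq> S" using assms by (auto intro: vec.subspace_add)
  from vec.dim_subset [OF this] vec.dim_sums_Int [OF assms(1,2)] show ?thesis by linarith
qed

text \<open>
  The min-max principle. The condition \<open>dim S < dim W + j\<close> says \<open>dim W \<ge> dim S - j + 1\<close> without a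
  truncated subtraction. An optimal \<open>W\<close> is spanned by the singular vectors whose singular value is at
  most the \<open>j\<close>-th one. Conversely, any \<open>W\<close> of that dimension meets the span of those whose singular
  value is at least the \<open>j\<close>-th one, since this span has dimension at least \<open>j\<close>.
\<close>

theorem
  fixes T :: "complex ^ 'n \<Rightarrow> complex ^ 'n"
  assumes S: "vec.subspace S" and lin: "Vector_Spaces.linear (*s) (*s) T"
    and j: "1 \<le> j" "j \<le> vec.dim S"
  shows singular_value_subspace:
    "\<exists>W. vec.subspace W \<and> W \<subseteq> S \<and> vec.dim S < vec.dim W + j \<and>
      (\<forall>x\<in>W. (norm (T x))\<^sup>2 \<le> (singular_value S T j)\<^sup>2 * (norm x)\<^sup>2)"
    and singular_value_le:
    "\<And>W c. vec.subspace W \<Longrightarrow> W \<subseteq> S \<Longrightarrow> vec.dim S < vec.dim W + j \<Longrightarrow>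
      (\<And>x. x \<in> W \<Longrightarrow> (norm (T x))\<^sup>2 \<le> c * (norm x)\<^sup>2) \<Longrightarrow> (singular_value S T j)\<^sup>2 \<le> c"
proof -
  obtain B where B: "orthonormal B" "vec.span B = S"
    and eig: "\<And>v. v \<in> B \<Longrightarrow> adjoint_on S T (T v) = of_real ((norm (T v))\<^sup>2) *s v"
    and orth: "\<And>v w. v \<in> B \<Longrightarrow> w \<in> B \<Longrightarrow> v \<noteq> w \<Longrightarrow> cinner (T v) (T w) = 0"
    using singular_vectors [OF S lin] by metis
  note sv = singular_values_eq_image [OF S lin B eig]
  have fin: "finite B" using B(1) by (simp add: orthonormal_def)
  have dimS: "vec.dim S = card B" using dim_span_orthonormal [OF B(1)] B(2) by simp
  define t where "t = singular_value S T j"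
  have sz: "size (filter_mset Q (singular_values S T)) = card {v \<in> B. Q (norm (T v))}" for Q
    by (simp add: sv filter_mset_image_mset filter_mset_mset_set fin)
  have "size (singular_values S T) = card B" by (simp add: sv)
  with j dimS have "j \<le> size (singular_values S T)" by simp
  from jth_largest [OF j(1) this]
  have card_gt: "card {v \<in> B. t < norm (T v)} < j" and t_mem: "t \<in># singular_values S T"
    and card_ge: "j \<le> card {v \<in> B. t \<le> norm (T v)}"
    by (simp_all add: sz t_def singular_value_def)
  have t0: "0 \<le> t" using t_mem by (auto simp: sv)
  have expand: "(norm (T x))\<^sup>2 = (\<Sum>v\<in>C. (cmod (cinner v x))\<^sup>2 * (norm (T v))\<^sup>2)"
    "(norm x)\<^sup>2 = (\<Sum>v\<in>C. (cmod (cinner v x))\<^sup>2)" if C: "C \<subseteq> B" "x \<in> vec.span C" for C x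
  proof -
    have onC: "orthonormal C" using orthonormal_subset [OF B(1) C(1)] .
    then have finC: "finite C" by (simp add: orthonormal_def)
    note exp = orthonormal_expansion [OF onC C(2)]
    have n1: "norm v = 1" if "v \<in> C" for v
    proof -
      have "cinner v v = 1" using onC that by (simp add: orthonormal_def)
      then have "(norm v)\<^sup>2 = 1" by (metis cinner_self of_real_eq_1_iff)
      then show ?thesis using norm_ge_zero [of v] by (simp add: power2_eq_1_iff)
    qed
    have "(norm (\<Sum>v\<in>C. cinner v x *s v))\<^sup>2 = (\<Sum>v\<in>C. (cmod (cinner v x))\<^sup>2 * (norm v)\<^sup>2)"
      by (rule norm_sum_orthogonal [OF finC]) (use onC in \<open>auto simp: orthonormal_def\<close>)
    then show "(norm x)\<^sup>2 = (\<Sum>v\<in>C. (cmod (cinner v x))\<^sup>2)"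
      using exp n1 by simp
    have "T x = (\<Sum>v\<in>C. cinner v x *s T v)"
      using arg_cong [OF exp, of T] by (simp add: vec.linear_sum [OF lin] vec.linear_scale [OF lin])
    then show "(norm (T x))\<^sup>2 = (\<Sum>v\<in>C. (cmod (cinner v x))\<^sup>2 * (norm (T v))\<^sup>2)"
      using norm_sum_orthogonal [OF finC, of T "\<lambda>v. cinner v x"] orth C(1) by auto
  qed
  show "\<exists>W. vec.subspace W \<and> W \<subseteq> S \<and> vec.dim S < vec.dim W + j \<and>
      (\<forall>x\<in>W. (norm (T x))\<^sup>2 \<le> (singular_value S T j)\<^sup>2 * (norm x)\<^sup>2)"
  proof (intro exI conjI ballI)
    let ?C = "{v \<in> B. norm (T v) \<le> t}"
    have CB: "?C \<subseteq> B" by auto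
    show "vec.subspace (vec.span ?C)" by (rule vec.subspace_span)
    show "vec.span ?C \<subseteq> S" unfolding B(2) [symmetric] by (rule vec.span_mono) auto
    have "?C = B - {v \<in> B. t < norm (T v)}" by auto
    then have "card ?C = card B - card {v \<in> B. t < norm (T v)}"
      using fin by (simp add: card_Diff_subset)
    moreover have "vec.dim (vec.span ?C) = card ?C"
      by (intro dim_span_orthonormal orthonormal_subset [OF B(1)]) auto
    ultimately show "vec.dim S < vec.dim (vec.span ?C) + j"
      using card_gt dimS by linarith
    show "(norm (T x))\<^sup>2 \<le> (singular_value S T j)\<^sup>2 * (norm x)\<^sup>2" if x: "x \<in> vec.span ?C" for x
      unfolding expand [OF CB x] t_def [symmetric] sum_distrib_left
    proof (rule sum_mono)
      fix v assume "v \<in> ?C"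
      then have "(norm (T v))\<^sup>2 \<le> t\<^sup>2" by (intro power_mono) auto
      then show "(cmod (cinner v x))\<^sup>2 * (norm (T v))\<^sup>2 \<le> t\<^sup>2 * (cmod (cinner v x))\<^sup>2"
        by (simp add: mult.commute [of _ "(cmod (cinner v x))\<^sup>2"] mult_left_mono)
    qed
  qed
  show "(singular_value S T j)\<^sup>2 \<le> c"
    if W: "vec.subspace W" "W \<subseteq> S" "vec.dim S < vec.dim W + j"
      and le: "\<And>x. x \<in> W \<Longrightarrow> (norm (T x))\<^sup>2 \<le> c * (norm x)\<^sup>2" for W c
  proof -
    let ?C = "{v \<in> B. t \<le> norm (T v)}"
    have CB: "?C \<subseteq> B" by auto
    let ?U = "vec.span ?C"
    have U: "vec.subspace ?U" "?U \<subseteq> S"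
      unfolding B(2) [symmetric] by (auto intro!: vec.span_mono)
    have "vec.dim ?U = card ?C"
      by (intro dim_span_orthonormal orthonormal_subset [OF B(1)]) auto
    then have "vec.dim (?U \<inter> W) \<noteq> 0"
      using dim_Int_ge [OF U(1) W(1) S U(2) W(2)] card_ge W(3) by linarith
    then obtain x where x: "x \<in> ?U" "x \<in> W" "x \<noteq> 0" by (auto simp: subset_iff)
    have "t\<^sup>2 * (norm x)\<^sup>2 \<le> (norm (T x))\<^sup>2"
      unfolding expand [OF CB x(1)] sum_distrib_left
    proof (rule sum_mono)
      fix v assume "v \<in> ?C"
      then have "t\<^sup>2 \<le> (norm (T v))\<^sup>2" using t0 by (intro power_mono) auto
      then show "t\<^sup>2 * (cmod (cinner v x))\<^sup>2 \<le> (cmod (cinner v x))\<^sup>2 * (norm (T v))\<^sup>2"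
        by (simp add: mult.commute [of _ "(cmod (cinner v x))\<^sup>2"] mult_left_mono)
    qed
    also have "\<dots> \<le> c * (norm x)\<^sup>2" using le x(2) .
    finally show ?thesis using x(3) by (simp add: t_def)
  qed
qed

section \<open>Compression to a hyperplane\<close>

lemma hyperplane_eq_orthogonal_complement:
  fixes h :: "complex ^ 'n"
  assumes "hyperplane S" "norm h = 1" "\<forall>x\<in>S. cinner h x = 0"
  shows "S = {x. cinner h x = 0}"
proof (rule vec.subspace_dim_equal)
  show "vec.subspace S" using assms(1) by (simp add: hyperplane_def)
  show H: "vec.subspace {x. cinner h x = 0}" by (simp add: vec.subspace_def cinner_simps)
  show "S \<subseteq> {x. cinner h x = 0}" using assms(3) by blast
  have "h \<notin> {x. cinner h x = 0}" using assms(2) by (simp add: cinner_self)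
  then have "{x. cinner h x = 0} \<subset> UNIV" by blast
  then have "vec.dim {x. cinner h x = 0} < vec.dim (UNIV :: (complex ^ 'n) set)"
    by (intro vec.dim_psubset) (simp only: vec.span_UNIV vec.span_eq_iff [THEN iffD2, OF H])
  then show "vec.dim S \<ge> vec.dim {x. cinner h x = 0}"
    using assms(1) unfolding vec_dim_card hyperplane_def by linarith
qed

lemma norm_reject:
  assumes "norm h = 1"
  shows "(norm (y - cinner h y *s h))\<^sup>2 = (norm y)\<^sup>2 - (cmod (cinner h y))\<^sup>2"
proof -
  have "cinner (y - cinner h y *s h) (cinner h y *s h) = 0"
    using assms by (simp add: cinner_simps cinner_self cnj_cinner)
  from norm_add_orthogonal [OF this] show ?thesis
    using assms by (simp add: norm_scale)
qed

lemma compression_eq: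
  assumes "norm h = 1" "S = {x. cinner h x = 0}"
  shows "compression S A x = A *v x - cinner h (A *v x) *s h"
  unfolding compression_def orth_proj_def
proof (rule the_equality)
  have S: "vec.subspace S" by (simp add: assms(2) vec.subspace_def cinner_simps)
  let ?z = "A *v x - cinner h (A *v x) *s h"
  show z: "?z \<in> S \<and> (\<forall>s\<in>S. cinner s (A *v x - ?z) = 0)"
  proof (intro conjI ballI)
    show "?z \<in> S" using assms by (simp add: cinner_simps cinner_self)
    show "cinner s (A *v x - ?z) = 0" if "s \<in> S" for s
    proof -
      have "cinner s h = 0" using that assms(2) cinner_commute_zero [of h s] by simp
      then show ?thesis by (simp add: cinner_scale_right)
    qed
  qed
  fix y assume y: "y \<in> S \<and> (\<forall>s\<in>S. cinner s (A *v x - y) = 0)"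
  show "y = ?z"
    by (rule cinner_eqI [OF S]) (use y z in \<open>auto simp: cinner_diff_right\<close>)
qed

lemma dim_Int_orthogonal_ge:
  assumes W: "vec.subspace W"
  shows "vec.dim W \<le> vec.dim {x \<in> W. cinner g x = 0} + 1"
proof (cases "W \<subseteq> {x. cinner g x = 0}")
  case True
  then have "{x \<in> W. cinner g x = 0} = W" by blast
  then show ?thesis by simp
next
  case False
  then obtain w where w: "w \<in> W" "cinner g w \<noteq> 0" by blast
  let ?Z = "{x \<in> W. cinner g x = 0}"
  have "W \<subseteq> vec.span (insert w ?Z)"
  proof
    fix x assume x: "x \<in> W"
    let ?y = "x - (cinner g x / cinner g w) *s w"
    have "?y \<in> W" by (intro vec.subspace_diff [OF W] vec.subspace_scale [OF W] x w(1))
    moreover have "cinner g ?y = 0" using w(2) by (simp add: cinner_simps)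
    ultimately have "?y \<in> vec.span ?Z" by (intro vec.span_base) simp
    then show "x \<in> vec.span (insert w ?Z)" unfolding vec.span_insert by blast
  qed
  then have "vec.dim W \<le> vec.dim (insert w ?Z)" by (rule vec.dim_mono)
  then show ?thesis by (simp add: vec.dim_insert split: if_splits)
qed

theorem corollary3p1:
  fixes A :: "complex ^ 'n ^ 'n" and h :: "complex ^ 'n" and S :: "(complex ^ 'n) set"
    and \<beta> :: real
  assumes "hyperplane S"
    and "norm h = 1"
    and "\<forall>x\<in>S. cinner h x = 0"
    and "\<beta> = min ((norm (A *v h))\<^sup>2) ((norm (conj_transpose A *v h))\<^sup>2)
              - (cmod (cinner h (A *v h)))\<^sup>2"
  shows "\<forall>j\<in>{1..CARD('n) - 1}.
           (singular_value UNIV ((*v) A) j)\<^sup>2 \<ge> (singular_value S (compression S A) j)\<^sup>2 \<and>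
           (singular_value S (compression S A) j)\<^sup>2 \<ge> (singular_value UNIV ((*v) A) (j + 1))\<^sup>2 - \<beta>"
proof
  fix j assume j: "j \<in> {1..CARD('n) - 1}"
  let ?T = "compression S A"
  define \<mu> where "\<mu> = singular_value S ?T j"
  note h = assms(2)
  note S_eq = hyperplane_eq_orthogonal_complement [OF assms(1-3)]
  note T_eq = compression_eq [OF h S_eq, of A]
  have S: "vec.subspace S" and dimS: "vec.dim S = CARD('n) - 1"
    using assms(1) by (simp_all add: hyperplane_def)
  have linA: "Vector_Spaces.linear (*s) (*s) ((*v) A)" by simp
  have linT: "Vector_Spaces.linear (*s) (*s) ?T"
    by (simp add: Vector_Spaces.linear_iff vec.vector_space_axioms T_eq matrix_vector_right_distrib
        vec.scale cinner_simps vec.scale_right_diff_distrib vec.scale_left_distrib)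
  have normT: "(norm (?T x))\<^sup>2 = (norm (A *v x))\<^sup>2 - (cmod (cinner h (A *v x)))\<^sup>2" for x
    unfolding T_eq by (rule norm_reject [OF h])
  note U = vec.subspace_UNIV vec_dim_card [where 'a = complex and 'n = 'n]
  have jU: "1 \<le> j" "j \<le> vec.dim (UNIV :: (complex ^ 'n) set)"
      "1 \<le> j + 1" "j + 1 \<le> vec.dim (UNIV :: (complex ^ 'n) set)"
    and jS: "1 \<le> j" "j \<le> vec.dim S"
    using j unfolding U(2) dimS by auto
  have upper: "\<mu>\<^sup>2 \<le> (singular_value UNIV ((*v) A) j)\<^sup>2"
  proof -
    obtain W where W: "vec.subspace W" "vec.dim (UNIV :: (complex ^ 'n) set) < vec.dim W + j"
      "\<forall>x\<in>W. (norm (A *v x))\<^sup>2 \<le> (singular_value UNIV ((*v) A) j)\<^sup>2 * (norm x)\<^sup>2"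
      using singular_value_subspace [OF U(1) linA jU(1,2)] by blast
    show ?thesis unfolding \<mu>_def
    proof (rule singular_value_le [OF S linT jS])
      show "vec.subspace (W \<inter> S)" using W(1) S by (rule vec.subspace_inter)
      show "vec.dim S < vec.dim (W \<inter> S) + j"
        using dim_Int_ge [OF W(1) S U(1)] W(2) by simp
      show "(norm (?T x))\<^sup>2 \<le> (singular_value UNIV ((*v) A) j)\<^sup>2 * (norm x)\<^sup>2" if "x \<in> W \<inter> S" for x
      proof -
        have "(norm (?T x))\<^sup>2 \<le> (norm (A *v x))\<^sup>2" by (simp add: normT)
        also have "\<dots> \<le> (singular_value UNIV ((*v) A) j)\<^sup>2 * (norm x)\<^sup>2" using W(3) that by simp
        finally show ?thesis .
      qed
    qed simp
  qed
  obtain W where W: "vec.subspace W" "W \<subseteq> S" "vec.dim S < vec.dim W + j"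
    and leW: "\<And>x. x \<in> W \<Longrightarrow> (norm (?T x))\<^sup>2 \<le> \<mu>\<^sup>2 * (norm x)\<^sup>2"
    using singular_value_subspace [OF S linT jS] unfolding \<mu>_def by blast
  have orthW: "cinner h x = 0" if "x \<in> W" for x using that W(2) S_eq by blast
  have lower_adjoint: "(singular_value UNIV ((*v) A) (j + 1))\<^sup>2
      \<le> \<mu>\<^sup>2 + ((norm (conj_transpose A *v h))\<^sup>2 - (cmod (cinner h (A *v h)))\<^sup>2)"
  proof (rule singular_value_le [OF U(1) linA jU(3,4) W(1)])
    show "vec.dim (UNIV :: (complex ^ 'n) set) < vec.dim W + (j + 1)"
      using W(3) unfolding U(2) dimS by linarith
    fix x assume x: "x \<in> W"
    \<comment> \<open>As \<open>x\<close> is orthogonal to \<open>h\<close>, only the component \<open>g\<close> of \<open>k\<close> in \<open>S\<close> matters.\<close>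
    define k where "k = conj_transpose A *v h"
    define g where "g = k - cinner h k *s h"
    have "cinner h (A *v x) = cinner g x"
      using orthW [OF x] by (simp add: cinner_adjoint_matrix g_def k_def cinner_simps)
    then have "(cmod (cinner h (A *v x)))\<^sup>2 \<le> (norm g * norm x)\<^sup>2"
      using cauchy_schwarz_cinner [of g x] by (simp add: power_mono)
    moreover have "cmod (cinner h k) = cmod (cinner h (A *v h))"
      by (metis cinner_adjoint_matrix cnj_cinner complex_mod_cnj k_def)
    then have "(norm g)\<^sup>2 = (norm k)\<^sup>2 - (cmod (cinner h (A *v h)))\<^sup>2"
      using norm_reject [OF h, of k] by (simp add: g_def)
    ultimately show "(norm (A *v x))\<^sup>2 \<le>
        (\<mu>\<^sup>2 + ((norm (conj_transpose A *v h))\<^sup>2 - (cmod (cinner h (A *v h)))\<^sup>2)) * (norm x)\<^sup>2"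
      using leW [OF x] normT [of x] by (simp add: k_def power_mult_distrib algebra_simps)
  qed simp
  have lower_direct: "(singular_value UNIV ((*v) A) (j + 1))\<^sup>2
      \<le> \<mu>\<^sup>2 + ((norm (A *v h))\<^sup>2 - (cmod (cinner h (A *v h)))\<^sup>2)"
  proof (rule singular_value_le [OF U(1) linA jU(3,4)])
    \<comment> \<open>Adding \<open>h\<close> gains the dimension that the condition \<open>\<langle>h, Ax\<rangle> = \<langle>A\<^sup>*h, x\<rangle> = 0\<close> may cost.\<close>
    let ?W1 = "vec.span (insert h W)"
    let ?Z = "{x \<in> ?W1. cinner (conj_transpose A *v h) x = 0}"
    show "vec.subspace ?Z"
      by (rule vec.subspaceI) (auto simp: cinner_simps intro: vec.span_zero vec.span_add vec.span_scale)
    have "h \<notin> vec.span W"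
    proof -
      have "h \<notin> W" using orthW [of h] h by (auto simp: cinner_self)
      moreover have "vec.span W = W" using W(1) by (simp only: vec.span_eq_iff)
      ultimately show ?thesis by (simp only: not_False_eq_True)
    qed
    then have "vec.dim ?W1 = vec.dim W + 1" by (simp add: vec.dim_insert)
    moreover have "vec.dim ?W1 \<le> vec.dim ?Z + 1"
      by (rule dim_Int_orthogonal_ge) (rule vec.subspace_span)
    ultimately show "vec.dim (UNIV :: (complex ^ 'n) set) < vec.dim ?Z + (j + 1)"
      using W(3) unfolding U(2) dimS by linarith
    fix x assume x: "x \<in> ?Z"
    obtain c where "x - c *s h \<in> vec.span W" using x by (auto simp: vec.span_insert)
    then obtain w where w: "w \<in> W" and x_eq: "x = w + c *s h"
      using W(1) by (metis diff_add_cancel vec.span_eq_iff)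
    have "cinner h (A *v x) = 0" using x by (simp add: cinner_adjoint_matrix)
    then have "A *v x = ?T x" by (simp add: T_eq)
    also have "\<dots> = ?T w + c *s ?T h"
      by (simp add: x_eq vec.linear_add [OF linT] vec.linear_scale [OF linT])
    finally have Ax: "A *v x = ?T w + c *s ?T h" .
    define p q r where "p = norm w" and "q = cmod c" and "r = norm (?T h)"
    have "norm (?T w) \<le> \<bar>\<mu>\<bar> * p"
      by (rule power2_le_imp_le) (use leW [OF w] in \<open>simp_all add: p_def power_mult_distrib\<close>)
    then have "norm (A *v x) \<le> \<bar>\<mu>\<bar> * p + q * r"
      unfolding Ax q_def r_def using norm_triangle_ineq [of "?T w" "c *s ?T h"]
      by (simp add: norm_scale)
    then have "(norm (A *v x))\<^sup>2 \<le> (\<bar>\<mu>\<bar> * p + q * r)\<^sup>2" by (simp add: power_mono)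
    \<comment> \<open>Lagrange's identity: the added square completes the product of the two sums of squares.\<close>
    also have "\<dots> \<le> (\<bar>\<mu>\<bar> * p + q * r)\<^sup>2 + (\<bar>\<mu>\<bar> * q - p * r)\<^sup>2" by simp
    also have "\<dots> = (\<bar>\<mu>\<bar>\<^sup>2 + r\<^sup>2) * (p\<^sup>2 + q\<^sup>2)" by algebra
    also have "p\<^sup>2 + q\<^sup>2 = (norm x)\<^sup>2"
    proof -
      have "cinner w (c *s h) = 0"
        using orthW [OF w] cinner_commute_zero [of h w] by (simp add: cinner_scale_right)
      from norm_add_orthogonal [OF this] h show ?thesis
        by (simp add: x_eq p_def q_def norm_scale)
    qed
    finally show "(norm (A *v x))\<^sup>2 \<le>
        (\<mu>\<^sup>2 + ((norm (A *v h))\<^sup>2 - (cmod (cinner h (A *v h)))\<^sup>2)) * (norm x)\<^sup>2"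
      by (simp add: r_def normT)
  qed simp
  show "(singular_value UNIV ((*v) A) j)\<^sup>2 \<ge> (singular_value S ?T j)\<^sup>2 \<and>
      (singular_value S ?T j)\<^sup>2 \<ge> (singular_value UNIV ((*v) A) (j + 1))\<^sup>2 - \<beta>"
    using upper lower_adjoint lower_direct assms(4) by (auto simp: \<mu>_def min_def)
qed

end
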